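(* (Calderón--Zygmund decomposition) Let $T$ be a tree rooted at infinity with vertex set $V$, endowed with a locally doubling flow measure $m$, and let $\widetilde C=\max\{2c,\beta-1,3\}$. For every $f\in L^1(m)$ and $\alpha>0$ there exist a family $\{E_i\}$ of pairwise disjoint admissible trapezoids and functions $g,b^i$ on $V$ such that $f=g+\sum_i b^i$ and (i) $|g|\le \widetilde C\alpha$; (ii) $b^i=0$ on $(E_i)^c$; (iii) $\|b^i\|_1\le 2\widetilde C\alpha\, m(E_i)$ and $\int_{E_i}b^i\,dm=0$; (iv) $\sum_i m(E_i)\le \frac{\|f\|_1}{\alpha}$.
   Context: Tree with root at infinity: $T=(V,E)$ is an (undirected) tree with geodesic distance $d$, $o\in V$ is a fixed origin, and a half-infinite geodesic starting at $o$ is fixed, identified with a boundary point, the root. For $x\in V$ let $\Pi(x)$ be the vertex of this geodesic closest to $x$; the level of $x$ is $\ell(x)=d(o,\Pi(x))-d(\Pi(x),x)$. Write $x\ge y$ iff $\ell(x)-\ell(y)=d(x,y)$. The set of sons of $x$ is $s(x)=\{y\sim x:\ \ell(y)=\ell(x)-1\}$, and $q(x)=|s(x)|$. Flow measure: a function $m:V\to(0,\infty)$ with $m(x)=\sum_{y\in s(x)}m(y)$ for all $x\in V$; also regarded as the measure $m(A)=\sum_{x\in A}m(x)$, with $\int_A f\,dm=\sum_{y\in A}f(y)m(y)$. It is locally doubling if for every $r>0$ there is $C_r>1$ with $m(B_{2r}(x))\le C_r m(B_r(x))$ for all $x\in V$, where $B_r(x)$ is the closed ball of radius $r$ for $d$.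 For a locally doubling flow there is a constant $c>1$, fixed once for all, such that $m(x)\le c\,m(y)$ for all $x\in V$, $y\in s(x)$, and $m(x)\ge\frac{c}{c-1}m(y)$ for all $x$ with $q(x)\ge2$ and $y\in s(x)$; in particular $q(x)\le c$ for all $x$. Admissible trapezoids: for integers $h''>h'\ge1$ and $x_0\in V$, $R_{h'}^{h''}(x_0)=\{x\in V:\ x\le x_0,\ \ell(x_0)-h''<\ell(x)\le \ell(x_0)-h'\}$. Fix $\beta\ge12$. The admissible trapezoids are all singletons $\{x_0\}$ and all $R_{h'}^{h''}(x_0)$ with $2\le h''/h'\le\beta$, $x_0\in V$. *)

theory Defs
  imports "HOL-Analysis.Analysis"
begin

text \<open>
  The vertex set is the whole type \<open>'v\<close>; a graph is given by its adjacency relation.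
\<close>

definition is_tree :: "('v \<Rightarrow> 'v \<Rightarrow> bool) \<Rightarrow> bool" where
  "is_tree adj \<longleftrightarrow>
     symp adj \<and> irreflp adj \<and>
     (\<forall>x y. adj\<^sup>*\<^sup>* x y) \<and>
     \<not> (\<exists>xs. length xs \<ge> 3 \<and> distinct xs \<and> successively adj xs \<and> adj (last xs) (hd xs))"

definition gdist :: "('v \<Rightarrow> 'v \<Rightarrow> bool) \<Rightarrow> 'v \<Rightarrow> 'v \<Rightarrow> nat" where
  "gdist adj x y = (LEAST n. (adj ^^ n) x y)"

definition gball :: "('v \<Rightarrow> 'v \<Rightarrow> bool) \<Rightarrow> real \<Rightarrow> 'v \<Rightarrow> 'v set" where
  "gball adj r x = {y. real (gdist adj x y) \<le> r}"

text \<open>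
  The root at infinity is given by a half-infinite geodesic \<open>\<gamma>\<close>; the origin is \<open>\<gamma> 0\<close>.
\<close>

definition geodesic_ray :: "('v \<Rightarrow> 'v \<Rightarrow> bool) \<Rightarrow> (nat \<Rightarrow> 'v) \<Rightarrow> bool" where
  "geodesic_ray adj \<gamma> \<longleftrightarrow> (\<forall>i j. i \<le> j \<longrightarrow> gdist adj (\<gamma> i) (\<gamma> j) = j - i)"

definition ray_proj :: "('v \<Rightarrow> 'v \<Rightarrow> bool) \<Rightarrow> (nat \<Rightarrow> 'v) \<Rightarrow> 'v \<Rightarrow> 'v" where
  "ray_proj adj \<gamma> x = arg_min (\<lambda>p. gdist adj p x) (\<lambda>p. p \<in> range \<gamma>)"

definition level :: "('v \<Rightarrow> 'v \<Rightarrow> bool) \<Rightarrow> (nat \<Rightarrow> 'v) \<Rightarrow> 'v \<Rightarrow> int" where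
  "level adj \<gamma> x =
     int (gdist adj (\<gamma> 0) (ray_proj adj \<gamma> x)) - int (gdist adj (ray_proj adj \<gamma> x) x)"

definition below :: "('v \<Rightarrow> 'v \<Rightarrow> bool) \<Rightarrow> (nat \<Rightarrow> 'v) \<Rightarrow> 'v \<Rightarrow> 'v \<Rightarrow> bool" where
  "below adj \<gamma> y x \<longleftrightarrow> level adj \<gamma> x - level adj \<gamma> y = int (gdist adj x y)"

definition sons :: "('v \<Rightarrow> 'v \<Rightarrow> bool) \<Rightarrow> (nat \<Rightarrow> 'v) \<Rightarrow> 'v \<Rightarrow> 'v set" where
  "sons adj \<gamma> x = {y. adj x y \<and> level adj \<gamma> y = level adj \<gamma> x - 1}"

text \<open>
  No local finiteness is presupposed, so the sum over the sons is an unconditional,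
  possibly infinite one.
\<close>

definition is_flow :: "('v \<Rightarrow> 'v \<Rightarrow> bool) \<Rightarrow> (nat \<Rightarrow> 'v) \<Rightarrow> ('v \<Rightarrow> real) \<Rightarrow> bool" where
  "is_flow adj \<gamma> m \<longleftrightarrow> (\<forall>x. m x > 0) \<and> (\<forall>x. (m has_sum m x) (sons adj \<gamma> x))"

definition flow_measure :: "('v \<Rightarrow> real) \<Rightarrow> 'v measure" where
  "flow_measure m = point_measure UNIV (\<lambda>x. ennreal (m x))"

definition locally_doubling :: "('v \<Rightarrow> 'v \<Rightarrow> bool) \<Rightarrow> ('v \<Rightarrow> real) \<Rightarrow> bool" where
  "locally_doubling adj m \<longleftrightarrow>
     (\<forall>r>0. \<exists>C>1. \<forall>x.
        emeasure (flow_measure m) (gball adj (2 * r) x)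
          \<le> ennreal C * emeasure (flow_measure m) (gball adj r x))"

text \<open>
  The constant \<open>c\<close> attached to a locally doubling flow. The first bound and the flow identity
  force \<open>sons adj \<gamma> x\<close> to be finite, so \<^const>\<open>card\<close> gives the genuine number of sons.
\<close>

definition flow_constant ::
    "('v \<Rightarrow> 'v \<Rightarrow> bool) \<Rightarrow> (nat \<Rightarrow> 'v) \<Rightarrow> ('v \<Rightarrow> real) \<Rightarrow> real \<Rightarrow> bool" where
  "flow_constant adj \<gamma> m c \<longleftrightarrow>
     c > 1 \<and>
     (\<forall>x. \<forall>y\<in>sons adj \<gamma> x. m x \<le> c * m y) \<and>
     (\<forall>x. card (sons adj \<gamma> x) \<ge> 2 \<longrightarrow> (\<forall>y\<in>sons adj \<gamma> x. m x \<ge> c / (c - 1) * m y))"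

definition trapezoid ::
    "('v \<Rightarrow> 'v \<Rightarrow> bool) \<Rightarrow> (nat \<Rightarrow> 'v) \<Rightarrow> nat \<Rightarrow> nat \<Rightarrow> 'v \<Rightarrow> 'v set" where
  "trapezoid adj \<gamma> h' h'' x0 =
     {x. below adj \<gamma> x x0 \<and>
         level adj \<gamma> x0 - int h'' < level adj \<gamma> x \<and> level adj \<gamma> x \<le> level adj \<gamma> x0 - int h'}"

definition admissible ::
    "('v \<Rightarrow> 'v \<Rightarrow> bool) \<Rightarrow> (nat \<Rightarrow> 'v) \<Rightarrow> real \<Rightarrow> 'v set \<Rightarrow> bool" where
  "admissible adj \<gamma> \<beta> A \<longleftrightarrow>
     (\<exists>x0. A = {x0}) \<or>
     (\<exists>x0 h' h''. 1 \<le> h' \<and> h' < h'' \<and> 2 \<le> real h'' / real h' \<and> real h'' / real h' \<le> \<beta> \<and>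
        A = trapezoid adj \<gamma> h' h'' x0)"

end

theory Submission
  imports Defs
begin

text \<open>
  Declare a piece (a singleton or an admissible trapezoid) bad when the mean of \<open>\<bar>f\<bar>\<close> on it exceeds
  \<open>\<alpha>\<close>. As \<open>m (R) = (h'' - h') m (x\<^sub>0)\<close>, the vertex set can be partitioned into admissible
  trapezoids that are too heavy to be bad. A trapezoid that is not bad is split, at level
  \<open>2 h'\<close> if \<open>h'' \<ge> 4 h'\<close> and along the sons of \<open>x\<^sub>0\<close> otherwise; each of its pieces carries at least
  the fraction \<open>1 / C\<close> of its mass, so a bad piece has mean at most \<open>C \<alpha>\<close> and is selected. The
  splitting ends with singletons, where not being bad means \<open>\<bar>f\<bar> \<le> \<alpha>\<close>.

  The heavy partition is built from \<open>W\<^sub>j\<close>, the vertices at depth at least \<open>H\<close> below the ancestor of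
  generation \<open>j H\<close> of a fixed vertex: \<open>W\<^sub>0\<close> is a union of dyadic trapezoids, and
  \<open>W\<^sub>j\<^sub>+\<^sub>1 - W\<^sub>j\<close> consists of one trapezoid of ratio \<open>2\<close> and of dyadic trapezoids below vertices
  whose parent lies on the ray of ancestors.
\<close>

subsection \<open>The parent map of a tree rooted at infinity\<close>

text \<open>If the next vertex already lies on the simple path, the path is cut back to it instead
  of being extended.\<close>

lemma rtranclp_imp_distinct_path:
  assumes "r\<^sup>*\<^sup>* x y"
  shows "\<exists>xs. xs \<noteq> [] \<and> distinct xs \<and> successively r xs \<and> hd xs = x \<and> last xs = y"
  using assms
proof (induction rule: rtranclp_induct)
  case base
  show ?case by (rule exI[of _ "[x]"]) simp
next
  case (step y z)
  then obtain xs where xs: "xs \<noteq> []" "distinct xs" "successively r xs" "hd xs = x" "last xs = y"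
    by blast
  show ?case
  proof (cases "z \<in> set xs")
    case True
    then obtain us vs where "xs = us @ z # vs" by (meson split_list)
    with xs show ?thesis
      by (intro exI[of _ "us @ [z]"]) (auto simp: successively_append_iff hd_append)
  next
    case False
    with xs step.hyps show ?thesis
      by (intro exI[of _ "xs @ [z]"]) (auto simp: successively_append_iff)
  qed
qed

section \<open>Distances and geodesics in a tree\<close>

locale infinite_rooted_tree =
  fixes adj :: "'v \<Rightarrow> 'v \<Rightarrow> bool" and \<gamma> :: "nat \<Rightarrow> 'v"
  assumes tree: "is_tree adj" and ray: "geodesic_ray adj \<gamma>"
begin

abbreviation d :: "'v \<Rightarrow> 'v \<Rightarrow> nat" where "d \<equiv> gdist adj"
abbreviation lev :: "'v \<Rightarrow> int" where "lev \<equiv> level adj \<gamma>"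

lemma adj_sym: "adj x y \<Longrightarrow> adj y x"
  using tree by (auto simp: is_tree_def dest: sympD)

lemma adj_irrefl: "\<not> adj x x"
  using tree by (auto simp: is_tree_def irreflp_def)

lemma connected: "adj\<^sup>*\<^sup>* x y"
  using tree by (auto simp: is_tree_def)

text \<open>A simple path avoiding the edge would close up with it to a cycle; it has at least three
  vertices, since the only two-vertex path is the removed edge.\<close>

lemma edge_removal_disconnects:
  assumes "adj x y"
  shows "\<not> (\<lambda>u v. adj u v \<and> {u, v} \<noteq> {x, y})\<^sup>*\<^sup>* x y"
proof
  let ?r = "\<lambda>u v. adj u v \<and> {u, v} \<noteq> {x, y}"
  assume "?r\<^sup>*\<^sup>* x y"
  then obtain xs where xs: "xs \<noteq> []" "distinct xs" "successively ?r xs" "hd xs = x" "last xs = y"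
    using rtranclp_imp_distinct_path[of ?r x y] by auto
  have "x \<noteq> y" using assms adj_irrefl by auto
  have "length xs \<ge> 3"
  proof (rule ccontr)
    assume "\<not> length xs \<ge> 3"
    then have "length xs = 0 \<or> length xs = 1 \<or> length xs = 2" by arith
    with xs \<open>x \<noteq> y\<close> show False
      by (auto simp: length_Suc_conv numeral_2_eq_2)
  qed
  moreover have "successively adj xs"
    using xs(3) by (rule successively_mono) auto
  moreover have "adj (last xs) (hd xs)" using assms adj_sym xs by auto
  ultimately show False using tree xs(2) unfolding is_tree_def by blast
qed

lemma walk_d: "(adj ^^ d x y) x y"
proof -
  obtain n where "(adj ^^ n) x y" using connected[of x y] by (auto simp: rtranclp_is_Sup_relpowp)
  then show ?thesis unfolding gdist_def by (rule LeastI)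
qed

lemma d_le_walk: "(adj ^^ n) x y \<Longrightarrow> d x y \<le> n"
  unfolding gdist_def by (rule Least_le)

lemma relpowp_adj_sym: "(adj ^^ n) x y \<Longrightarrow> (adj ^^ n) y x"
proof (induction n arbitrary: y)
  case (Suc n)
  then obtain z where "(adj ^^ n) x z" "adj z y" by auto
  with Suc.IH adj_sym show ?case by (meson relpowp_Suc_I2)
qed auto

lemma d_sym: "d x y = d y x"
  by (meson antisym d_le_walk relpowp_adj_sym walk_d)

lemma d_eq_0 [simp]: "d x y = 0 \<longleftrightarrow> x = y"
  using walk_d[of x y] d_le_walk[of 0 x y] by auto

lemma d_refl [simp]: "d x x = 0"
  by simp

lemma d_step: "adj y z \<Longrightarrow> d x z \<le> Suc (d x y)"
  by (meson d_le_walk relpowp_Suc_I walk_d)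

lemma d_predecessor:
  assumes "d x y = Suc n"
  obtains z where "d x z = n" "adj z y"
proof -
  obtain z where z: "(adj ^^ n) x z" "adj z y" using walk_d[of x y] assms by auto
  with d_step[of z y x] assms d_le_walk[OF z(1)] have "d x z = n" by simp
  with z that show ?thesis by blast
qed

text \<open>Meant for \<open>adj\<close> with one edge deleted: along a geodesic from
  \<open>x\<close> the distance grows by one per edge and stays within \<open>d x y\<close>, which
  suffices to see that the deleted edge is not met.\<close>

lemma reach_within:
  assumes "\<And>u v. adj u v \<Longrightarrow> d x v = Suc (d x u) \<Longrightarrow> d x v \<le> d x y \<Longrightarrow> r u v"
  shows "r\<^sup>*\<^sup>* x y"
  using assms
proof (induction "d x y" arbitrary: y)
  case (Suc n)
  then obtain z where z: "d x z = n" "adj z y" by (metis d_predecessor)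
  have "r\<^sup>*\<^sup>* x z" using Suc z by (metis le_SucI)
  moreover have "r z y" using Suc z by simp
  ultimately show ?case by simp
qed auto

text \<open>Edges of a geodesic from \<open>r\<close> join different distances, so the geodesics to
  \<open>x\<close> and \<open>y\<close> would miss an edge between equal distances and together
  bypass it.\<close>

lemma d_adj_neq:
  assumes "adj x y"
  shows "d r x \<noteq> d r y"
proof
  assume eq: "d r x = d r y"
  let ?r = "\<lambda>u v. adj u v \<and> {u, v} \<noteq> {x, y}"
  have "?r\<^sup>*\<^sup>* r x" "?r\<^sup>*\<^sup>* r y"
    by (rule reach_within; use eq in \<open>force simp: doubleton_eq_iff\<close>)+
  moreover have "symp ?r" using adj_sym by (auto simp: symp_def doubleton_eq_iff)
  ultimately have "?r\<^sup>*\<^sup>* x y"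
    by (meson rtranclp_trans symp_rtranclp sympD)
  with edge_removal_disconnects[OF assms] show False by simp
qed

lemma d_adj_cases:
  assumes "adj x y"
  obtains "d r y = Suc (d r x)" | "d r x = Suc (d r y)"
  using d_adj_neq[OF assms, of r] d_step[OF assms, of r] d_step[OF adj_sym[OF assms], of r]
  by linarith

text \<open>With a second predecessor \<open>z\<close>, the edge from \<open>x\<close> to
  \<open>z\<close>, the geodesic back to \<open>r\<close> and the one out to \<open>y\<close> would
  bypass the edge between \<open>x\<close> and \<open>y\<close>: neither geodesic gets as far as
  \<open>x\<close>.\<close>

lemma d_predecessor_unique:
  assumes "adj y x" "adj z x" "d r x = Suc (d r y)" "d r x = Suc (d r z)"
  shows "y = z"
proof (rule ccontr)
  assume "y \<noteq> z"
  let ?r = "\<lambda>u v. adj u v \<and> {u, v} \<noteq> {x, y}"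
  have ry: "?r\<^sup>*\<^sup>* r y" and rz: "?r\<^sup>*\<^sup>* r z"
    by (rule reach_within; use assms in \<open>force simp: doubleton_eq_iff\<close>)+
  have "?r x z" using assms \<open>y \<noteq> z\<close> adj_sym by (auto simp: doubleton_eq_iff)
  moreover have "symp ?r" using adj_sym by (auto simp: symp_def doubleton_eq_iff)
  then have "?r\<^sup>*\<^sup>* z r" by (rule sympD[OF symp_rtranclp rz])
  ultimately have "?r\<^sup>*\<^sup>* x y"
    using ry by (rule converse_rtranclp_into_rtranclp[OF _ rtranclp_trans])
  with edge_removal_disconnects[OF adj_sym[OF assms(1)]] show False by simp
qed

section \<open>Levels, the parent map and the order\<close>

lemma ray_adj: "adj (\<gamma> n) (\<gamma> (Suc n))"
proof -
  have "d (\<gamma> n) (\<gamma> (Suc n)) = 1" using ray by (simp add: geodesic_ray_def)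
  with walk_d[of "\<gamma> n" "\<gamma> (Suc n)"] show ?thesis by auto
qed

text \<open>
  The distance to the ray has no local maximum along the ray, so it increases with slope one
  beyond the projection; thus \<^const>\<open>level\<close> is the Busemann function of the ray.
\<close>

lemma level_eventually:
  "\<forall>\<^sub>F n in sequentially. lev x = int n - int (d (\<gamma> n) x)"
proof -
  have "ray_proj adj \<gamma> x \<in> range \<gamma>" and min: "d (ray_proj adj \<gamma> x) x \<le> d (\<gamma> n) x" for n
    using arg_min_nat_lemma[of "\<lambda>p. p \<in> range \<gamma>" "\<gamma> 0" "\<lambda>p. d p x"]
    by (auto simp: ray_proj_def)
  then obtain k where k: "ray_proj adj \<gamma> x = \<gamma> k" by auto
  have inc: "d x (\<gamma> (Suc (k + n))) = Suc (d x (\<gamma> (k + n)))" for n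
  proof (induction n)
    case 0
    show ?case
      using ray_adj[of k] min[of "Suc k"] unfolding k
      by (auto simp: d_sym elim: d_adj_cases[of _ _ x])
  next
    case (Suc n)
    have "\<gamma> (k + n) \<noteq> \<gamma> (Suc (Suc (k + n)))"
    proof
      assume eq: "\<gamma> (k + n) = \<gamma> (Suc (Suc (k + n)))"
      have "d (\<gamma> (k + n)) (\<gamma> (Suc (Suc (k + n)))) = 2"
        using ray by (simp add: geodesic_ray_def)
      then show False by (simp flip: eq)
    qed
    then show ?case
      using Suc.IH d_predecessor_unique[OF ray_adj adj_sym[OF ray_adj], of x "k + n"]
        ray_adj[of "Suc (k + n)"]
      by (auto elim: d_adj_cases[of _ _ x])
  qed
  have "d (\<gamma> (k + n)) x = n + d (\<gamma> k) x" for n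
    by (induction n) (use inc in \<open>auto simp: d_sym[of _ x]\<close>)
  moreover have "d (\<gamma> 0) (\<gamma> k) = k" using ray by (simp add: geodesic_ray_def)
  ultimately have "lev x = int (k + n) - int (d (\<gamma> (k + n)) x)" for n
    by (simp add: level_def k)
  then show ?thesis unfolding eventually_sequentially by (metis le_iff_add)
qed

text \<open>The Busemann expression is nondecreasing in \<open>n\<close>, because a step along the
  ray adds at most one to the distance, and its eventual value is the level.\<close>

lemma level_lower_bound: "int n - int (d (\<gamma> n) x) \<le> lev x"
proof -
  have mono: "int n - int (d (\<gamma> n) x) \<le> int (n + i) - int (d (\<gamma> (n + i)) x)" for i
  proof (induction i)
    case (Suc i)
    then show ?case using d_step[OF ray_adj[of "n + i"], of x] by (simp add: d_sym)
  qed simp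
  obtain k where "\<And>n. n \<ge> k \<Longrightarrow> lev x = int n - int (d (\<gamma> n) x)"
    using level_eventually unfolding eventually_sequentially by blast
  from this[of "n + k"] mono[of k] show ?thesis by simp
qed

lemma level_adj_cases:
  assumes "adj x y"
  obtains "lev y = lev x + 1" | "lev x = lev y + 1"
proof -
  have "\<forall>\<^sub>F n in sequentially. lev x = int n - int (d (\<gamma> n) x) \<and> lev y = int n - int (d (\<gamma> n) y)"
    by (intro eventually_conj level_eventually)
  then obtain n where "lev x = int n - int (d (\<gamma> n) x)" "lev y = int n - int (d (\<gamma> n) y)"
    using eventually_happens'[OF sequentially_bot] by blast
  with d_adj_cases[OF assms, of "\<gamma> n"] that show ?thesis by force
qed

lemma ex1_parent: "\<exists>!y. adj x y \<and> lev y = lev x + 1"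
proof (rule ex_ex1I)
  have "\<forall>\<^sub>F n in sequentially. lev x = int n - int (d (\<gamma> n) x) \<and> n > nat (lev x)"
    by (intro eventually_conj level_eventually eventually_gt_at_top)
  \<comment> \<open>As \<open>n\<close> exceeds the level, \<open>x\<close> is not the ray point
    itself; the last vertex before \<open>x\<close> on the geodesic from that point turns out to be
    the parent.\<close>
  then obtain n where n: "lev x = int n - int (d (\<gamma> n) x)" "n > nat (lev x)"
    using eventually_happens'[OF sequentially_bot] by blast
  then have "d (\<gamma> n) x \<noteq> 0" by linarith
  then obtain k where "d (\<gamma> n) x = Suc k" using not0_implies_Suc by blast
  then obtain z where z: "d (\<gamma> n) x = Suc (d (\<gamma> n) z)" "adj z x" by (metis d_predecessor)
  with n level_lower_bound[of n z] have "lev z > lev x" by simp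
  with z(2) show "\<exists>y. adj x y \<and> lev y = lev x + 1"
    by (metis adj_sym level_adj_cases less_add_one less_asym)
next
  fix y z
  assume yz: "adj x y \<and> lev y = lev x + 1" "adj x z \<and> lev z = lev x + 1"
  have "\<forall>\<^sub>F n in sequentially. lev x = int n - int (d (\<gamma> n) x) \<and>
      lev y = int n - int (d (\<gamma> n) y) \<and> lev z = int n - int (d (\<gamma> n) z)"
    by (intro eventually_conj level_eventually)
  then obtain n where "lev x = int n - int (d (\<gamma> n) x)"
      "lev y = int n - int (d (\<gamma> n) y)" "lev z = int n - int (d (\<gamma> n) z)"
    using eventually_happens'[OF sequentially_bot] by blast
  with yz show "y = z"
    by (intro d_predecessor_unique[of y x z "\<gamma> n"]) (auto intro: adj_sym)
qed

definition parent :: "'v \<Rightarrow> 'v" where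
  "parent x = (THE y. adj x y \<and> lev y = lev x + 1)"

lemma adj_parent: "adj x (parent x)" and level_parent: "lev (parent x) = lev x + 1"
  using theI'[OF ex1_parent[of x]] by (auto simp: parent_def)

lemma parent_eqI: "adj x y \<Longrightarrow> lev y = lev x + 1 \<Longrightarrow> parent x = y"
  using ex1_parent[of x] adj_parent level_parent by blast

lemma sons_eq: "sons adj \<gamma> x = {y. parent y = x}"
  using adj_parent level_parent parent_eqI adj_sym by (force simp: sons_def)

lemma level_funpow_parent: "lev ((parent ^^ n) x) = lev x + int n"
  by (induction n) (auto simp: level_parent)

lemma level_diff_le_d: "lev x - lev y \<le> int (d x y)"
proof -
  have "(adj ^^ n) x y \<Longrightarrow> lev x - lev y \<le> int n" for n
  proof (induction n arbitrary: y)
    case (Suc n)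
    then obtain z where "(adj ^^ n) x z" "adj z y" by auto
    with Suc.IH[of z] show ?case by (auto elim: level_adj_cases)
  qed auto
  with walk_d show ?thesis by blast
qed

text \<open>A geodesic from \<open>x\<close> whose length equals the total drop in level must
  descend along every edge, since no edge changes the level by more than one.\<close>

lemma below_iff: "below adj \<gamma> y x \<longleftrightarrow> (\<exists>n. (parent ^^ n) y = x)"
proof
  show "\<exists>n. (parent ^^ n) y = x" if "below adj \<gamma> y x"
    using that
  proof (induction "d x y" arbitrary: y)
    case 0
    then show ?case by (intro exI[of _ 0]) simp
  next
    case (Suc n)
    then obtain z where z: "d x z = n" "adj z y" by (metis d_predecessor)
    have y: "lev x - lev y = int (Suc n)" using Suc by (simp add: below_def)
    with z level_diff_le_d[of x z] level_adj_cases[OF z(2)] have lz: "lev z = lev y + 1" by fastforce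
    with y z have "below adj \<gamma> z x" by (simp add: below_def)
    with Suc z obtain k where "(parent ^^ k) z = x" by metis
    moreover have "parent y = z" using z lz adj_sym by (intro parent_eqI) auto
    ultimately have "(parent ^^ Suc k) y = x" by (simp add: funpow_swap1)
    then show ?case ..
  qed
next
  assume "\<exists>n. (parent ^^ n) y = x"
  then obtain n where n: "(parent ^^ n) y = x" ..
  have "(adj ^^ n) y ((parent ^^ n) y)" by (induction n) (auto simp: adj_parent)
  with n have "d x y \<le> n" by (metis d_le_walk d_sym)
  with level_funpow_parent[of n y] level_diff_le_d[of x y] n show "below adj \<gamma> y x"
    by (auto simp: below_def)
qed

text \<open>Every edge joins a vertex to its parent, so each step of a path from \<open>x\<close> to
  \<open>y\<close> costs one more application of \<open>parent\<close> on one of the two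
  sides.\<close>

lemma common_ancestor: "\<exists>i j. (parent ^^ i) x = (parent ^^ j) y"
  using connected[of x y]
proof (induction rule: rtranclp_induct)
  case base
  show ?case by blast
next
  case (step y z)
  then obtain i j where ij: "(parent ^^ i) x = (parent ^^ j) y" by blast
  from step.hyps(2) show ?case
  proof (cases rule: level_adj_cases)
    case 1
    then have "parent y = z" using step.hyps by (intro parent_eqI)
    with ij have "(parent ^^ Suc i) x = (parent ^^ j) z" by (simp add: funpow_swap1)
    then show ?thesis by blast
  next
    case 2
    then have "parent z = y" using step.hyps adj_sym by (intro parent_eqI) auto
    with ij have "(parent ^^ i) x = (parent ^^ Suc j) z" by (simp add: funpow_swap1)
    then show ?thesis by blast
  qed
qed

lemma trapezoid_eq: "trapezoid adj \<gamma> a b x = {y. \<exists>n\<in>{a..<b}. (parent ^^ n) y = x}"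
  by (auto simp: trapezoid_def below_iff level_funpow_parent Bex_def)

end

subsection \<open>Flows along a parent map\<close>

text \<open>The tree is now seen only through its parent map: \<open>acyclic\<close> reflects that
  the parent raises the level, and \<open>confluent\<close> is the existence of common
  ancestors.\<close>

locale parent_flow =
  fixes p :: "'v \<Rightarrow> 'v" and m :: "'v \<Rightarrow> real" and c :: real
  assumes acyclic: "(p ^^ i) x = (p ^^ j) x \<Longrightarrow> i = j"
    and confluent: "\<exists>i j. (p ^^ i) x = (p ^^ j) y"
    and m_pos: "0 < m x"
    and m_sons: "(m has_sum m x) {y. p y = x}"
    and c_gt_1: "1 < c"
    and m_parent_le: "m (p y) \<le> c * m y"
begin

section \<open>Generations of descendants, their finiteness and mass\<close>

definition gen :: "nat \<Rightarrow> 'v \<Rightarrow> 'v set" where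
  "gen n x = {y. (p ^^ n) y = x}"

definition gens :: "nat set \<Rightarrow> 'v \<Rightarrow> 'v set" where
  "gens S x = (\<Union>n\<in>S. gen n x)"

abbreviation trap :: "nat \<Rightarrow> nat \<Rightarrow> 'v \<Rightarrow> 'v set" where
  "trap a b \<equiv> gens {a..<b}"

abbreviation low :: "nat \<Rightarrow> 'v \<Rightarrow> 'v set" where
  "low h \<equiv> gens {h..}"

lemma gen_0 [simp]: "gen 0 x = {x}"
  by (auto simp: gen_def)

lemma gen_Suc: "gen (Suc n) x = (\<Union>y\<in>{y. p y = x}. gen n y)"
  by (auto simp: gen_def)

lemma gen_disjoint: "i \<noteq> j \<Longrightarrow> gen i x \<inter> gen j x = {}"
  using acyclic by (auto simp: gen_def)

text \<open>Each son carries at least \<open>m x / c\<close> and together they carry at most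
  \<open>m x\<close>, so there are at most \<open>c\<close> of them.\<close>

lemma finite_sons: "finite {y. p y = x}"
proof (rule ccontr)
  assume inf: "infinite {y. p y = x}"
  obtain n where n: "c < real n" using reals_Archimedean2 by blast
  obtain B where B: "finite B" "card B = n" "B \<subseteq> {y. p y = x}"
    using infinite_arbitrarily_large[OF inf] by blast
  have "real n * m x = (\<Sum>y\<in>B. m x)" using B by simp
  also have "\<dots> \<le> (\<Sum>y\<in>B. c * m y)"
    using B m_parent_le by (intro sum_mono) auto
  also have "\<dots> = c * sum m B" by (simp add: sum_distrib_left)
  also have "\<dots> \<le> c * m x"
    using m_pos B c_gt_1
    by (intro mult_left_mono finite_sum_le_has_sum[OF m_sons]) (auto simp: less_imp_le)
  finally show False using n m_pos[of x] by simp
qed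

lemma sum_sons: "(\<Sum>y | p y = x. m y) = m x"
  by (rule has_sum_unique[OF has_sum_finite[OF finite_sons] m_sons])

lemma m_le_parent: "m y \<le> m (p y)"
proof -
  have "m y \<le> (\<Sum>z | p z = p y. m z)"
    by (rule member_le_sum) (auto simp: less_imp_le m_pos finite_sons)
  then show ?thesis by (simp add: sum_sons)
qed

lemma m_le_ancestor: "m y \<le> m ((p ^^ n) y)"
proof (induction n)
  case (Suc n)
  also have "m ((p ^^ n) y) \<le> m ((p ^^ Suc n) y)" using m_le_parent by simp
  finally show ?case .
qed simp

lemma finite_gen: "finite (gen n x)"
proof (induction n arbitrary: x)
  case (Suc n)
  then show ?case unfolding gen_Suc by (intro finite_UN_I finite_sons)
qed simp

text \<open>By the flow equation mass is conserved between generations; hence a trapezoid weighs its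
  number of generations times the flow at its top.\<close>

lemma sum_gen: "sum m (gen n x) = m x"
proof (induction n arbitrary: x)
  case (Suc n)
  have "sum m (gen (Suc n) x) = (\<Sum>y | p y = x. sum m (gen n y))"
    unfolding gen_Suc
    by (rule sum.UNION_disjoint) (use finite_gen finite_sons in \<open>auto simp: gen_def\<close>)
  with Suc.IH sum_sons show ?case by simp
qed simp

lemma finite_gens: "finite S \<Longrightarrow> finite (gens S x)"
  by (simp add: gens_def finite_gen)

lemma sum_gens:
  assumes "finite S"
  shows "sum m (gens S x) = real (card S) * m x"
proof -
  have "sum m (gens S x) = (\<Sum>n\<in>S. sum m (gen n x))"
    unfolding gens_def using gen_disjoint assms by (intro sum.UNION_disjoint) (auto simp: finite_gen)
  then show ?thesis by (simp add: sum_gen)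
qed

lemma gens_Un: "gens (S \<union> T) x = gens S x \<union> gens T x"
  by (auto simp: gens_def)

lemma gens_disjoint:
  assumes "S \<inter> T = {}"
  shows "gens S x \<inter> gens T x = {}"
proof (rule ccontr)
  assume "gens S x \<inter> gens T x \<noteq> {}"
  then obtain y i j where ij: "i \<in> S" "j \<in> T" "(p ^^ i) y = x" "(p ^^ j) y = x"
    by (auto simp: gens_def gen_def)
  then have "i = j" using acyclic[of i y j] by simp
  with ij assms show False by auto
qed

lemma gens_image_Suc: "gens (Suc ` S) x = (\<Union>y\<in>{y. p y = x}. gens S y)"
  by (auto simp: gens_def gen_Suc)

text \<open>A common descendant of siblings reaches \<open>x\<close> through either of them;
  \<open>acyclic\<close> makes the two numbers of steps agree, so the siblings coincide.\<close>

lemma gens_sons_disjoint: "disjoint_family_on (gens S) {y. p y = x}"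
  unfolding disjoint_family_on_def
proof (intro ballI impI)
  fix y z assume yz: "y \<in> {y. p y = x}" "z \<in> {y. p y = x}" "y \<noteq> z"
  show "gens S y \<inter> gens S z = {}"
  proof (rule ccontr)
    assume "gens S y \<inter> gens S z \<noteq> {}"
    then obtain w i j where w: "(p ^^ i) w = y" "(p ^^ j) w = z"
      by (auto simp: gens_def gen_def)
    with yz have "(p ^^ Suc i) w = (p ^^ Suc j) w" by simp
    then have "i = j" using acyclic by blast
    with w yz show False by simp
  qed
qed

lemma trap_Suc: "trap (Suc a) (Suc b) x = (\<Union>y\<in>{y. p y = x}. trap a b y)"
  using gens_image_Suc[of "{a..<b}"] by simp

lemma low_Suc: "low (Suc h) x = (\<Union>y\<in>{y. p y = x}. low h y)"
proof -
  have "{Suc h..} = Suc ` {h..}" by (auto dest: Suc_le_D)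
  then show ?thesis by (simp only: gens_image_Suc)
qed

text \<open>By \<open>confluent\<close>, every vertex lies in a finite generation below some
  ancestor of a fixed vertex.\<close>

lemma countable_vertices: "countable (UNIV :: 'v set)"
proof -
  fix v :: 'v
  have "UNIV = (\<Union>i. \<Union>j. gen i ((p ^^ j) v))"
    using confluent[of _ v] by (auto simp: gen_def)
  moreover have "countable \<dots>" by (simp add: countable_finite finite_gen)
  ultimately show ?thesis by simp
qed

section \<open>Dyadic tiling of a cone of descendants\<close>

lemma dyadic_interval:
  assumes "h \<ge> 1" "h \<le> n"
  shows "\<exists>i. 2 ^ i * h \<le> n \<and> n < 2 ^ Suc i * (h :: nat)"
proof -
  define k where "k = (LEAST i. n < 2 ^ Suc i * h)"
  have "n < 2 ^ Suc n * h"
    using assms less_exp[of "Suc n"] by (metis Suc_lessD less_le_trans mult.right_neutral mult_le_mono2)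
  then have k: "n < 2 ^ Suc k * h" unfolding k_def by (rule LeastI)
  have "2 ^ k * h \<le> n"
  proof (cases k)
    case (Suc i)
    with not_less_Least[of i "\<lambda>i. n < 2 ^ Suc i * h"] show ?thesis by (simp add: k_def)
  qed (use assms in simp)
  with k show ?thesis by blast
qed

lemma low_dyadic:
  assumes "h \<ge> 1"
  shows "low h x = (\<Union>i. trap (2 ^ i * h) (2 ^ Suc i * h) x)"
proof -
  have "h \<le> n" if "2 ^ i * h \<le> n" for i n :: nat
  proof -
    have "h \<le> 2 ^ i * h" by simp
    with that show ?thesis by linarith
  qed
  then have "{h..} = (\<Union>i. {2 ^ i * h..<2 ^ Suc i * h})"
    using dyadic_interval[OF assms] by (auto simp del: power_Suc)
  then show ?thesis by (auto simp: gens_def simp del: power_Suc)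
qed

lemma dyadic_disjoint:
  "disjoint_family (\<lambda>i. trap (2 ^ i * h) (2 ^ Suc i * h) x)"
proof -
  have *: "trap (2 ^ i * h) (2 ^ Suc i * h) x \<inter> trap (2 ^ j * h) (2 ^ Suc j * h) x = {}"
    if "i < j" for i j
  proof (rule gens_disjoint)
    have "2 ^ Suc i * h \<le> 2 ^ j * h" using that by (intro mult_le_mono1 power_increasing) auto
    then show "{2 ^ i * h..<2 ^ Suc i * h} \<inter> {2 ^ j * h..<2 ^ Suc j * h} = {}"
      by (auto simp del: power_Suc)
  qed
  show ?thesis unfolding disjoint_family_on_def
  proof (intro ballI impI)
    fix i j :: nat assume "i \<noteq> j"
    then consider "i < j" | "j < i" by linarith
    then show "trap (2 ^ i * h) (2 ^ Suc i * h) x \<inter> trap (2 ^ j * h) (2 ^ Suc j * h) x = {}"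
      by cases (use * in blast)+
  qed
qed

end

section \<open>Stopping-time selection for \<open>F\<close>, the norm of the function, with
  \<open>N\<close> its total integral\<close>

locale calderon_zygmund = parent_flow p m c
  for p :: "'v \<Rightarrow> 'v" and m c +
  fixes F :: "'v \<Rightarrow> real" and \<alpha> \<beta> C N :: real
  assumes F_nonneg: "0 \<le> F x"
    and F_le: "finite A \<Longrightarrow> (\<Sum>x\<in>A. F x * m x) \<le> N"
    and \<alpha>_pos: "0 < \<alpha>"
    and \<beta>: "12 \<le> \<beta>"
    and C: "2 * c \<le> C" "\<beta> - 1 \<le> C" "3 \<le> C"
begin

definition adm :: "'v set \<Rightarrow> bool" where
  "adm A \<longleftrightarrow> (\<exists>x. A = {x}) \<or>
     (\<exists>a b x. 1 \<le> a \<and> a < b \<and> 2 * a \<le> b \<and> b \<le> \<beta> * a \<and> A = trap a b x)"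

abbreviation mass :: "'v set \<Rightarrow> real" where "mass \<equiv> sum m"
abbreviation int_F :: "'v set \<Rightarrow> real" where "int_F A \<equiv> \<Sum>x\<in>A. F x * m x"

text \<open>The strict lower bound makes selected sets nonempty and controls their total mass; the
  upper bound controls the means on them.\<close>

definition cz_family :: "'v set set \<Rightarrow> 'v set \<Rightarrow> bool" where
  "cz_family P A \<longleftrightarrow> disjoint P \<and> \<Union>P \<subseteq> A \<and>
     (\<forall>E\<in>P. adm E \<and> \<alpha> * mass E < int_F E \<and> int_F E \<le> C * \<alpha> * mass E) \<and>
     (\<forall>x\<in>A - \<Union>P. F x \<le> \<alpha>)"

definition cz :: "'v set \<Rightarrow> bool" where
  "cz A \<longleftrightarrow> (\<exists>P. cz_family P A)"

lemma m_parent_le_C: "m (p y) \<le> C * m y"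
proof -
  have "c * m y \<le> C * m y" using C c_gt_1 m_pos[of y] by (intro mult_right_mono) auto
  with m_parent_le show ?thesis by (rule order_trans)
qed

lemma adm_finite: "adm A \<Longrightarrow> finite A"
  by (auto simp: adm_def finite_gens)

text \<open>Each family stays inside its own set, so families for disjoint sets can simply be
  merged.\<close>

lemma cz_UN:
  assumes "disjoint_family_on A I" "\<And>i. i \<in> I \<Longrightarrow> cz (A i)"
  shows "cz (\<Union>i\<in>I. A i)"
proof -
  obtain P where P: "\<And>i. i \<in> I \<Longrightarrow> cz_family (P i) (A i)"
    using assms(2) unfolding cz_def by metis
  then have disj: "\<And>i. i \<in> I \<Longrightarrow> disjoint (P i)"
    and sub: "\<And>i E. i \<in> I \<Longrightarrow> E \<in> P i \<Longrightarrow> E \<subseteq> A i"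
    and bad: "\<And>i E. i \<in> I \<Longrightarrow> E \<in> P i \<Longrightarrow>
      adm E \<and> \<alpha> * mass E < int_F E \<and> int_F E \<le> C * \<alpha> * mass E"
    and good: "\<And>i x. i \<in> I \<Longrightarrow> x \<in> A i - \<Union>(P i) \<Longrightarrow> F x \<le> \<alpha>"
    unfolding cz_family_def by (simp_all add: Sup_le_iff)
  have "cz_family (\<Union>i\<in>I. P i) (\<Union>i\<in>I. A i)"
    unfolding cz_family_def
  proof (intro conjI)
    show "disjoint (\<Union>i\<in>I. P i)"
    proof (rule pairwiseI)
      fix E G assume "E \<in> (\<Union>i\<in>I. P i)" "G \<in> (\<Union>i\<in>I. P i)" and "E \<noteq> G"
      then obtain i j where ij: "i \<in> I" "j \<in> I" "E \<in> P i" "G \<in> P j" by blast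
      show "disjnt E G"
      proof (cases "i = j")
        case True
        with disj[OF ij(1)] ij \<open>E \<noteq> G\<close> show ?thesis by (auto simp: pairwise_def)
      next
        case False
        with assms(1) ij have "A i \<inter> A j = {}" by (auto simp: disjoint_family_on_def)
        moreover have "E \<subseteq> A i" "G \<subseteq> A j" using sub ij by auto
        ultimately show ?thesis by (auto simp: disjnt_def disjoint_iff subset_iff)
      qed
    qed
  next
    show "\<Union>(\<Union>i\<in>I. P i) \<subseteq> (\<Union>i\<in>I. A i)" using sub by blast
  next
    show "\<forall>E\<in>\<Union>i\<in>I. P i. adm E \<and> \<alpha> * mass E < int_F E \<and> int_F E \<le> C * \<alpha> * mass E"
      using bad by (meson UN_E)
  next
    show "\<forall>x\<in>(\<Union>i\<in>I. A i) - \<Union>(\<Union>i\<in>I. P i). F x \<le> \<alpha>"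
    proof
      fix x assume "x \<in> (\<Union>i\<in>I. A i) - \<Union>(\<Union>i\<in>I. P i)"
      then obtain i where "i \<in> I" "x \<in> A i - \<Union>(P i)" by blast
      then show "F x \<le> \<alpha>" by (rule good)
    qed
  qed
  then show ?thesis unfolding cz_def by (rule exI)
qed

lemma cz_Un: "cz A \<Longrightarrow> cz B \<Longrightarrow> A \<inter> B = {} \<Longrightarrow> cz (A \<union> B)"
  using cz_UN[where I = UNIV and A = "\<lambda>i. if i then A else B"]
  by (simp add: disjoint_family_on_def UNIV_bool Int_commute Un_commute[of B])

lemma cz_singleton: "int_F {x} \<le> \<alpha> * mass {x} \<Longrightarrow> cz {x}"
  unfolding cz_def cz_family_def using m_pos[of x] by (intro exI[of _ "{}"]) auto

text \<open>One stopping step. The integral over a bad child \<open>B\<close> is at most that over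
  the good set \<open>A\<close>, hence at most \<open>C * \<alpha> * mass B\<close>, and
  \<open>{B}\<close> is the family. For a good child the last premise defers to the
  recursion.\<close>

lemma cz_child:
  assumes "adm B" "B \<subseteq> A" "finite A" "int_F A \<le> \<alpha> * mass A" "mass A \<le> C * mass B"
    and "int_F B \<le> \<alpha> * mass B \<Longrightarrow> cz B"
  shows "cz B"
proof (cases "int_F B \<le> \<alpha> * mass B")
  case False
  have "int_F B \<le> int_F A"
    using assms(2,3) F_nonneg m_pos by (intro sum_mono2) (auto simp: less_imp_le)
  also have "\<dots> \<le> \<alpha> * mass A" by (rule assms(4))
  also have "\<dots> \<le> \<alpha> * (C * mass B)" using assms(5) \<alpha>_pos by simp
  finally show ?thesis
    unfolding cz_def cz_family_def using False assms(1) by (intro exI[of _ "{B}"]) (auto simp: ac_simps)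
qed (rule assms(6))

lemma adm_trap: "1 \<le> a \<Longrightarrow> 2 * a \<le> b \<Longrightarrow> real b \<le> \<beta> * real a \<Longrightarrow> adm (trap a b x)"
  unfolding adm_def by (intro disjI2 exI[of _ a] exI[of _ b] exI[of _ x]) auto

lemma cz_trap:
  assumes "1 \<le> a" "2 * a \<le> b" "real b \<le> \<beta> * real a"
    and "int_F (trap a b x) \<le> \<alpha> * mass (trap a b x)"
  shows "cz (trap a b x)"
  using assms
\<comment> \<open>This measure drops in every split: when \<open>b\<close> is lowered to
  \<open>2 * a\<close>, when \<open>a\<close> is doubled, and when both decrease by one.\<close>
proof (induction "2 * b - a" arbitrary: a b x rule: less_induct)
  case less
  note child = cz_child[OF _ _ finite_gens[OF finite_atLeastLessThan] less.prems(4)]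
  have a_le: "2 * real a \<le> \<beta> * real a" by (intro mult_right_mono) (use \<beta> in auto)
  consider "4 * a \<le> b" | "b < 4 * a" "2 \<le> a" | "b < 4 * a" "a = 1"
    using less.prems(1) by linarith
  then show ?case
  proof cases
    case 1
    have split: "trap a b x = trap a (2 * a) x \<union> trap (2 * a) b x"
      using 1 by (subst gens_Un[symmetric], subst ivl_disj_un_two(3)) auto
    have "cz (trap a (2 * a) x)"
    proof (rule child)
      show "adm (trap a (2 * a) x)" using less.prems a_le by (intro adm_trap) auto
      \<comment> \<open>Origin of \<open>\<beta> - 1\<close> in the constant: \<open>b - a\<close>
        is at most \<open>(\<beta> - 1) * a\<close>.\<close>
      have "real (b - a) \<le> C * real a"
        using less.prems(2,3) mult_right_mono[OF C(2), of "real a"] 1 by (simp add: algebra_simps)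
      with m_pos[of x] show "mass (trap a b x) \<le> C * mass (trap a (2 * a) x)"
        by (simp add: sum_gens)
    next
      assume "int_F (trap a (2 * a) x) \<le> \<alpha> * mass (trap a (2 * a) x)"
      with 1 less.prems a_le show "cz (trap a (2 * a) x)"
        by (intro less.hyps) auto
    next
      show "trap a (2 * a) x \<subseteq> trap a b x" unfolding split by (rule Un_upper1)
    qed
    moreover have "cz (trap (2 * a) b x)"
    proof (rule child)
      show "adm (trap (2 * a) b x)" using less.prems 1 \<beta> by (intro adm_trap) auto
      \<comment> \<open>Equivalent to \<open>5 * a \<le> 2 * b\<close>, which follows from
        \<open>4 * a \<le> b\<close>; here the constant 3 enters.\<close>
      have "real (b - a) \<le> 3 * real (b - 2 * a)"
        using 1 by simp
      also have "\<dots> \<le> C * real (b - 2 * a)" using C by (intro mult_right_mono) auto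
      finally show "mass (trap a b x) \<le> C * mass (trap (2 * a) b x)"
        using m_pos[of x] by (simp add: sum_gens)
    next
      assume "int_F (trap (2 * a) b x) \<le> \<alpha> * mass (trap (2 * a) b x)"
      with 1 less.prems \<beta> show "cz (trap (2 * a) b x)"
        by (intro less.hyps) auto
    next
      show "trap (2 * a) b x \<subseteq> trap a b x" unfolding split by (rule Un_upper2)
    qed
    ultimately show ?thesis unfolding split by (rule cz_Un) (auto intro!: gens_disjoint)
  next
    case 2
    then obtain a' b' where ab: "a = Suc a'" "b = Suc b'" "1 \<le> a'"
      using less.prems(2) by (cases a; cases b) auto
    have b': "2 * a' \<le> b'" using ab less.prems(2) by simp
    \<comment> \<open>Passing to the sons raises the ratio, but \<open>b < 4 * a\<close> gives
      \<open>b' \<le> 4 * a' + 2\<close>, which is at most \<open>6 * a'\<close>.\<close>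
    have "real b' \<le> 6 * real a'" using 2(1) ab by simp
    also have "\<dots> \<le> \<beta> * real a'" using \<beta> by (intro mult_right_mono) auto
    finally have b'2: "real b' \<le> \<beta> * real a'" .
    have "cz (trap a' b' y)" if "y \<in> {y. p y = x}" for y
    proof (rule child)
      show "adm (trap a' b' y)" using ab b' b'2 by (intro adm_trap)
      show "trap a' b' y \<subseteq> trap a b x" using that unfolding ab trap_Suc by blast
      have "m x \<le> C * m y"
        using m_parent_le_C[of y] that by auto
      then have "real (b - a) * m x \<le> real (b - a) * (C * m y)" by (intro mult_left_mono) auto
      then show "mass (trap a b x) \<le> C * mass (trap a' b' y)"
        by (simp add: sum_gens ab ac_simps)
    next
      assume "int_F (trap a' b' y) \<le> \<alpha> * mass (trap a' b' y)"
      with ab b' b'2 show "cz (trap a' b' y)" by (intro less.hyps) auto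
    qed
    then show ?thesis unfolding ab trap_Suc by (intro cz_UN gens_sons_disjoint)
  next
    case 3
    \<comment> \<open>Below the sons the generations would start at 0, which is not admissible. So
      each son \<open>y\<close> is split off as a singleton, and if \<open>b = 3\<close> its own
      sons form the piece \<open>trap 1 2 y\<close>.\<close>
    define b' where "b' = b - 1"
    with 3 less.prems(2) have b: "b = Suc b'" "b' = 1 \<or> b' = 2" by auto
    have trap_x: "trap a b x = (\<Union>y\<in>{y. p y = x}. trap 0 b' y)"
      using 3 b by (simp flip: trap_Suc)
    have t01: "trap 0 1 y = {y}" for y by (simp add: gens_def)
    have sub: "trap 0 b' y \<subseteq> trap a b x" if "p y = x" for y
      using that unfolding trap_x by blast
    have single: "cz {y}" if "p y = x" for y
    proof (rule child)
      show "adm {y}" by (simp add: adm_def)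
      have "0 \<in> {0..<b'}" using b(2) by auto
      then have "y \<in> trap 0 b' y" unfolding gens_def using gen_0 by blast
      with sub[OF that] show "{y} \<subseteq> trap a b x" by blast
      \<comment> \<open>Up to two generations below \<open>x\<close> are compared with a single son,
        whence \<open>2 * c\<close> in the constant.\<close>
      have "real (b - a) * m x \<le> 2 * (c * m y)"
      proof (rule mult_mono)
        show "real (b - a) \<le> 2" using b 3 by auto
        show "m x \<le> c * m y" using m_parent_le[of y] that by simp
      qed (use m_pos[of x] in auto)
      also have "\<dots> \<le> C * m y" using mult_right_mono[OF C(1), of "m y"] m_pos[of y] by simp
      finally show "mass (trap a b x) \<le> C * mass {y}" by (simp add: sum_gens)
    qed (rule cz_singleton)
    have "cz (trap 0 b' y)" if "y \<in> {y. p y = x}" for y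
      using b(2)
    proof
      assume "b' = 1"
      with t01 single that show ?thesis by simp
    next
      assume b'2: "b' = 2"
      have split: "trap 0 b' y = trap 0 1 y \<union> trap 1 2 y"
        unfolding b'2 gens_Un[symmetric] by (subst ivl_disj_un_two(3)) auto
      have "cz (trap 1 2 y)"
      proof (rule child)
        show "adm (trap 1 2 y)" using \<beta> by (intro adm_trap) auto
        show "trap 1 2 y \<subseteq> trap a b x" using sub[of y] split that by blast
        have "m x \<le> c * m y" using m_parent_le[of y] that by simp
        then have "m x * 2 \<le> C * m y"
          using mult_right_mono[OF C(1) less_imp_le[OF m_pos[of y]]] by linarith
        then show "mass (trap a b x) \<le> C * mass (trap 1 2 y)"
          using 3 b b'2 by (simp add: sum_gens)
      next
        assume "int_F (trap 1 2 y) \<le> \<alpha> * mass (trap 1 2 y)"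
        with \<beta> b b'2 3 show "cz (trap 1 2 y)" by (intro less.hyps) auto
      qed
      moreover have "cz (trap 0 1 y)" unfolding t01 using single that by simp
      ultimately show ?thesis unfolding split by (intro cz_Un gens_disjoint) auto
    qed
    then show ?thesis unfolding trap_x by (intro cz_UN gens_sons_disjoint)
  qed
qed

text \<open>Each dyadic tile weighs at least \<open>h * m x\<close>, while \<open>N\<close> bounds
  the integral of \<open>F\<close> over it; so the second premise ensures that no tile is
  bad.\<close>

lemma cz_low:
  assumes "1 \<le> h" "N \<le> \<alpha> * (real h * m x)"
  shows "cz (low h x)"
proof -
  have "cz (trap (2 ^ i * h) (2 ^ Suc i * h) x)" for i
  proof (rule cz_trap)
    have "2 * real (2 ^ i * h) \<le> \<beta> * real (2 ^ i * h)" by (intro mult_right_mono) (use \<beta> in auto)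
    then show "real (2 ^ Suc i * h) \<le> \<beta> * real (2 ^ i * h)" by simp
    have "int_F (trap (2 ^ i * h) (2 ^ Suc i * h) x) \<le> \<alpha> * (real h * m x)"
      using F_le[OF finite_gens[OF finite_atLeastLessThan]] assms(2) by (rule order_trans)
    also have "\<dots> \<le> \<alpha> * (real (2 ^ i * h) * m x)"
      using mult_right_mono[of 1 "2 ^ i" "real h"] m_pos[of x] \<alpha>_pos by (intro mult_left_mono mult_right_mono) auto
    finally show "int_F (trap (2 ^ i * h) (2 ^ Suc i * h) x)
      \<le> \<alpha> * mass (trap (2 ^ i * h) (2 ^ Suc i * h) x)"
      by (simp add: sum_gens ac_simps)
  next
    show "1 \<le> 2 ^ i * h" using assms(1) by simp
  qed simp
  then show ?thesis
    unfolding low_dyadic[OF assms(1)] by (intro cz_UN dyadic_disjoint)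
qed

section \<open>Exhausting the vertex set by heavy pieces\<close>

lemma cz_empty: "cz {}"
  using cz_UN[of "\<lambda>_. {}" "{}"] by (simp add: disjoint_family_on_def)

lemma low_subset_ancestor: "low h x \<subseteq> low (h + i) ((p ^^ i) x)"
proof (induction i)
  case (Suc i)
  have "low (h + i) ((p ^^ i) x) \<subseteq> low (h + Suc i) ((p ^^ Suc i) x)"
    unfolding add_Suc_right low_Suc by auto
  with Suc.IH show ?case by blast
qed simp

text \<open>
  Going up one generation adds the descendants of the siblings, whose flow is at least \<open>1 / c\<close>
  times that of their parent; this lower bound does not deteriorate along the ray.
\<close>

lemma cz_ascend:
  assumes "1 \<le> H" "c * N \<le> \<alpha> * (real H * m v)" "m v \<le> m x" "H \<le> h"
  shows "cz (low (h + i) ((p ^^ i) x) - low h x)"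
proof (induction i)
  case 0
  then show ?case by (simp add: cz_empty)
next
  case (Suc i)
  define u where "u = (p ^^ i) x"
  have disj: "low (h + i) u \<inter> low (h + i) y = {}" if "y \<in> {y. p y = p u} - {u}" for y
    using gens_sons_disjoint[of "{h + i..}" "p u"] that by (auto simp: disjoint_family_on_def)
  have low: "low h x \<subseteq> low (h + i) u" unfolding u_def by (rule low_subset_ancestor)
  have "low (h + Suc i) ((p ^^ Suc i) x) = (\<Union>y\<in>{y. p y = p u}. low (h + i) y)"
    unfolding add_Suc_right low_Suc by (simp add: u_def)
  also have "\<dots> = low (h + i) u \<union> (\<Union>y\<in>{y. p y = p u} - {u}. low (h + i) y)"
    by blast
  finally have eq: "low (h + Suc i) ((p ^^ Suc i) x) - low h x =
      (low (h + i) u - low h x) \<union> (\<Union>y\<in>{y. p y = p u} - {u}. low (h + i) y)"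
    using low disj by blast
  have "cz (\<Union>y\<in>{y. p y = p u} - {u}. low (h + i) y)"
  proof (rule cz_UN)
    show "disjoint_family_on (low (h + i)) ({y. p y = p u} - {u})"
      by (rule disjoint_family_on_mono[OF _ gens_sons_disjoint[of _ "p u"]]) auto
  next
    fix y assume "y \<in> {y. p y = p u} - {u}"
    then have y: "p y = p u" by simp
    have "m v \<le> m (p y)"
      using assms(3) m_le_ancestor[of x "Suc i"] y by (simp add: u_def)
    with m_parent_le[of y] have vy: "m v \<le> c * m y" by linarith
    have "c * N \<le> \<alpha> * (real H * m v)" by (rule assms(2))
    also have "\<dots> \<le> \<alpha> * (real (h + i) * (c * m y))"
      using vy assms(4) \<alpha>_pos m_pos[of v] by (intro mult_left_mono mult_mono) auto
    also have "\<dots> = c * (\<alpha> * (real (h + i) * m y))" by (simp add: ac_simps)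
    finally have "N \<le> \<alpha> * (real (h + i) * m y)" using c_gt_1 by simp
    with assms(1,4) show "cz (low (h + i) y)" by (intro cz_low) auto
  qed
  with Suc.IH show ?case
    unfolding eq using disj by (intro cz_Un) (auto simp: u_def)
qed

lemma cz_UNIV: "cz UNIV"
proof -
  fix v :: 'v
  \<comment> \<open>The factor \<open>c\<close> compensates for the siblings met on the way up,
    whose flow may be as small as \<open>m v / c\<close>.\<close>
  obtain n :: nat where n: "c * N / (\<alpha> * m v) < real n" using reals_Archimedean2 by blast
  define H where "H = Suc n"
  have H: "1 \<le> H" by (simp add: H_def)
  have \<alpha>v: "0 < \<alpha> * m v" using \<alpha>_pos m_pos by simp
  have "c * N / (\<alpha> * m v) \<le> real H" using n by (simp add: H_def)
  then have cN: "c * N \<le> \<alpha> * (real H * m v)" using \<alpha>v by (simp add: divide_le_eq ac_simps)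
  have "0 \<le> N" using F_le[of "{}"] by simp
  then have "N \<le> c * N" using c_gt_1 mult_right_mono[of 1 c N] by simp
  with cN have N: "N \<le> \<alpha> * (real H * m v)" by linarith
  define W where "W j = low H ((p ^^ (j * H)) v)" for j
  \<comment> \<open>The new top lies \<open>H\<close> generations above the old one, so
    \<open>W j\<close> sits at depth at least \<open>2 * H\<close> below it; the depths from
    \<open>H\<close> to \<open>2 * H - 1\<close> form the trapezoid.\<close>
  have W_Suc: "W (Suc j) = trap H (2 * H) ((p ^^ (Suc j * H)) v) \<union>
      low (H + H) ((p ^^ H) ((p ^^ (j * H)) v))" for j
  proof -
    have "{H..} = {H..<2 * H} \<union> {H + H..}" by auto
    then have "low H w = trap H (2 * H) w \<union> low (H + H) w" for w using gens_Un by metis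
    then show ?thesis by (simp add: W_def funpow_add)
  qed
  have sub: "W j \<subseteq> low (H + H) ((p ^^ H) ((p ^^ (j * H)) v))" for j
    unfolding W_def by (rule low_subset_ancestor)
  then have "mono W" unfolding mono_iff_le_Suc using W_Suc by blast
  have "cz (disjointed W j)" for j
  proof (cases j)
    case 0
    then show ?thesis using cz_low[OF H N] by (simp add: disjointed_def W_def)
  next
    case (Suc k)
    define w where "w = (p ^^ (Suc k * H)) v"
    have w: "(p ^^ H) ((p ^^ (k * H)) v) = w" by (simp add: w_def funpow_add)
    have disj: "trap H (2 * H) w \<inter> low (H + H) w = {}" by (rule gens_disjoint) auto
    have "cz (trap H (2 * H) w)"
    proof (rule cz_trap)
      show "real (2 * H) \<le> \<beta> * real H" using mult_right_mono[of 2 \<beta> "real H"] \<beta> by simp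
      have "int_F (trap H (2 * H) w) \<le> N" by (intro F_le finite_gens) simp
      also have "\<dots> \<le> \<alpha> * (real H * m w)"
        unfolding w_def by (rule order_trans[OF N]) (intro mult_left_mono m_le_ancestor; use \<alpha>_pos in simp)
      finally show "int_F (trap H (2 * H) w) \<le> \<alpha> * mass (trap H (2 * H) w)"
        by (simp add: sum_gens)
    qed (use H in auto)
    moreover have "cz (low (H + H) w - W k)"
      using cz_ascend[OF H cN m_le_ancestor order_refl, of H "k * H"] unfolding W_def w .
    moreover have "disjointed W j = trap H (2 * H) w \<union> (low (H + H) w - W k)"
      using disj sub[of k] unfolding Suc disjointed_mono[OF \<open>mono W\<close>] W_Suc w w_def[symmetric]
      by blast
    ultimately show ?thesis using disj by (auto intro!: cz_Un)
  qed
  then have "cz (\<Union>j. disjointed W j)" by (intro cz_UN disjoint_family_disjointed)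
  moreover have "(\<Union>j. W j) = UNIV"
  proof -
    have "\<exists>j. x \<in> W j" for x
    proof -
      obtain i k where ik: "(p ^^ i) x = (p ^^ k) v" using confluent by blast
      \<comment> \<open>The index \<open>Suc k\<close> puts the top of \<open>W (Suc k)\<close> at
        least \<open>H\<close> generations above the common ancestor, because
        \<open>k \<le> k * H\<close>.\<close>
      have le: "k \<le> Suc k * H" "H \<le> Suc k * H - k + i"
      proof -
        show "k \<le> Suc k * H" by (simp add: H_def)
        have "k \<le> k * H" by (simp add: H_def)
        then show "H \<le> Suc k * H - k + i" unfolding mult_Suc by linarith
      qed
      have "(p ^^ (Suc k * H - k + i)) x = (p ^^ (Suc k * H - k)) ((p ^^ k) v)"
        by (simp add: funpow_add ik del: mult_Suc)
      also have "\<dots> = (p ^^ (Suc k * H - k + k)) v" by (simp add: funpow_add del: mult_Suc)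
      also have "\<dots> = (p ^^ (Suc k * H)) v" using le(1) by simp
      finally have "x \<in> W (Suc k)" using le(2) by (auto simp: W_def gens_def gen_def)
      then show ?thesis ..
    qed
    then show ?thesis by auto
  qed
  ultimately show ?thesis by (simp add: UN_disjointed_eq)
qed

end

subsection \<open>Integration against a flow measure\<close>

lemma emeasure_flow_measure:
  "(\<And>x. 0 \<le> m x) \<Longrightarrow> finite A \<Longrightarrow> emeasure (flow_measure m) A = ennreal (sum m A)"
  by (simp add: flow_measure_def emeasure_point_measure_finite2 sum_ennreal)

lemma measure_flow_measure:
  "(\<And>x. 0 \<le> m x) \<Longrightarrow> finite A \<Longrightarrow> measure (flow_measure m) A = sum m A"
  by (simp add: measure_def emeasure_flow_measure sum_nonneg)

lemma sets_flow_measure [simp]: "sets (flow_measure m) = UNIV"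
  by (simp add: flow_measure_def sets_point_measure)

lemma space_flow_measure [simp]: "space (flow_measure m) = UNIV"
  by (simp add: flow_measure_def space_point_measure)

text \<open>Such a function is a finite combination of indicators of points; integrals of bad parts
  thereby become finite sums.\<close>

lemma has_bochner_integral_flow_finite_support:
  fixes f :: "'v \<Rightarrow> 'b :: {banach, second_countable_topology}"
  assumes "\<And>x. 0 \<le> m x" "finite A" "\<And>x. x \<notin> A \<Longrightarrow> f x = 0"
  shows "has_bochner_integral (flow_measure m) f (\<Sum>x\<in>A. m x *\<^sub>R f x)"
proof -
  have "f x = (\<Sum>a\<in>A. indicator {a} x *\<^sub>R f a)" for x
  proof -
    have "indicator {a} x *\<^sub>R f a = (if x = a then f a else 0)" for a by simp
    then show ?thesis using assms(2,3) by simp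
  qed
  then have f: "f = (\<lambda>x. \<Sum>a\<in>A. indicator {a} x *\<^sub>R f a)" ..
  have "has_bochner_integral (flow_measure m) (\<lambda>x. indicator {a} x *\<^sub>R f a) (m a *\<^sub>R f a)" for a
  proof (rule has_bochner_integral_scaleR_left)
    show "has_bochner_integral (flow_measure m) (indicator {a}) (m a)"
      using has_bochner_integral_real_indicator[of "{a}" "flow_measure m"] assms(1)
      by (simp add: emeasure_flow_measure measure_flow_measure)
  qed
  then have "has_bochner_integral (flow_measure m) (\<lambda>x. \<Sum>a\<in>A. indicator {a} x *\<^sub>R f a)
      (\<Sum>a\<in>A. m a *\<^sub>R f a)"
    by (intro has_bochner_integral_sum)
  then show ?thesis by (simp flip: f)
qed

lemma sum_norm_le_flow_integral:
  fixes f :: "'v \<Rightarrow> 'b :: {banach, second_countable_topology}"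
  assumes "\<And>x. 0 \<le> m x" "finite A" "integrable (flow_measure m) f"
  shows "(\<Sum>x\<in>A. norm (f x) * m x) \<le> (LINT x|flow_measure m. norm (f x))"
proof -
  let ?h = "\<lambda>x. indicator A x * norm (f x)"
  have h: "has_bochner_integral (flow_measure m) ?h (\<Sum>x\<in>A. m x *\<^sub>R ?h x)"
    using assms(1,2) by (rule has_bochner_integral_flow_finite_support) simp
  have "(\<Sum>x\<in>A. norm (f x) * m x) = (LINT x|flow_measure m. ?h x)"
    unfolding has_bochner_integral_integral_eq[OF h] by (intro sum.cong) auto
  also have "\<dots> \<le> (LINT x|flow_measure m. norm (f x))"
    using h assms(3)
    by (intro integral_mono) (auto simp: has_bochner_integral_iff indicator_def)
  finally show ?thesis .
qed

text \<open>Subtracting the mean makes the integral over \<open>E\<close> vanish. The mean has norm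
  at most \<open>K\<close>, and integrating \<open>norm (f x) + K\<close> over \<open>E\<close>
  gives the factor 2.\<close>

lemma bad_part_estimates:
  fixes f :: "'v \<Rightarrow> 'b :: {banach, second_countable_topology}" and m :: "'v \<Rightarrow> real"
  assumes m: "\<And>x. 0 < m x" and E: "finite E" "E \<noteq> {}"
    and f: "(\<Sum>x\<in>E. norm (f x) * m x) \<le> K * sum m E"
  defines "avg \<equiv> (\<Sum>x\<in>E. m x *\<^sub>R f x) /\<^sub>R sum m E"
  defines "b \<equiv> (\<lambda>x. if x \<in> E then f x - avg else 0)"
  shows "norm avg \<le> K"
    and "integrable (flow_measure m) b"
    and "(LINT x|flow_measure m. norm (b x)) \<le> 2 * K * measure (flow_measure m) E"
    and "(LINT x:E|flow_measure m. b x) = 0"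
proof -
  have m0: "0 \<le> m x" for x using m by (simp add: less_imp_le)
  have mE: "0 < sum m E" using m E by (simp add: sum_pos)
  have "norm (\<Sum>x\<in>E. m x *\<^sub>R f x) \<le> (\<Sum>x\<in>E. norm (f x) * m x)"
    by (rule sum_norm_le) (simp add: m0 mult.commute)
  with f have "norm (\<Sum>x\<in>E. m x *\<^sub>R f x) \<le> K * sum m E" by linarith
  then show avg: "norm avg \<le> K"
    using mE by (simp add: avg_def divide_le_eq divide_inverse_commute[symmetric])
  have b: "has_bochner_integral (flow_measure m) b (\<Sum>x\<in>E. m x *\<^sub>R b x)"
    using m0 E(1) by (rule has_bochner_integral_flow_finite_support) (simp add: b_def)
  then show "integrable (flow_measure m) b" by (simp add: has_bochner_integral_iff)
  have nb: "has_bochner_integral (flow_measure m) (\<lambda>x. norm (b x)) (\<Sum>x\<in>E. m x *\<^sub>R norm (b x))"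
    using m0 E(1) by (rule has_bochner_integral_flow_finite_support) (simp add: b_def)
  have "(LINT x|flow_measure m. norm (b x)) = (\<Sum>x\<in>E. m x * norm (f x - avg))"
    unfolding has_bochner_integral_integral_eq[OF nb] by (simp add: b_def)
  also have "\<dots> \<le> (\<Sum>x\<in>E. norm (f x) * m x + K * m x)"
  proof (rule sum_mono)
    fix x
    have "norm (f x - avg) \<le> norm (f x) + K" using norm_triangle_ineq4[of "f x" avg] avg by simp
    then have "m x * norm (f x - avg) \<le> m x * (norm (f x) + K)" using m0 by (rule mult_left_mono)
    then show "m x * norm (f x - avg) \<le> norm (f x) * m x + K * m x" by (simp add: algebra_simps)
  qed
  also have "\<dots> \<le> 2 * K * sum m E"
    using f by (simp add: sum.distrib flip: sum_distrib_left)
  finally show "(LINT x|flow_measure m. norm (b x)) \<le> 2 * K * measure (flow_measure m) E"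
    using m0 E by (simp add: measure_flow_measure)
  have "(\<lambda>x. indicator E x *\<^sub>R b x) = b" by (auto simp: b_def)
  then have "(LINT x:E|flow_measure m. b x) = (\<Sum>x\<in>E. m x *\<^sub>R b x)"
    using has_bochner_integral_integral_eq[OF b] by (simp add: set_lebesgue_integral_def)
  also have "\<dots> = (\<Sum>x\<in>E. m x *\<^sub>R f x) - sum m E *\<^sub>R avg"
    by (simp add: b_def scaleR_diff_right sum_subtractf scaleR_left.sum)
  also have "\<dots> = 0" using mE by (simp add: avg_def)
  finally show "(LINT x:E|flow_measure m. b x) = 0" .
qed

section \<open>Assembling the decomposition on the whole tree\<close>

theorem theorem3p6:
  fixes adj :: "'v \<Rightarrow> 'v \<Rightarrow> bool"
    and \<gamma> :: "nat \<Rightarrow> 'v"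
    and m :: "'v \<Rightarrow> real"
    and c \<beta> \<alpha> C :: real
    and f :: "'v \<Rightarrow> 'k :: {real_normed_field, banach, second_countable_topology}"
  assumes tree: "is_tree adj"
    and ray: "geodesic_ray adj \<gamma>"
    and flow: "is_flow adj \<gamma> m"
    and doubling: "locally_doubling adj m"
    and c: "flow_constant adj \<gamma> m c"
    and beta: "\<beta> \<ge> 12"
    and C: "C = Max {2 * c, \<beta> - 1, 3}"
    and f: "integrable (flow_measure m) f"
    and alpha: "\<alpha> > 0"
  shows "\<exists>(I :: nat set) (E :: nat \<Rightarrow> 'v set) (g :: 'v \<Rightarrow> 'k) (b :: nat \<Rightarrow> 'v \<Rightarrow> 'k).
      (\<forall>i\<in>I. admissible adj \<gamma> \<beta> (E i)) \<and>
      disjoint_family_on E I \<and>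
      (\<forall>x. ((\<lambda>i. b i x) has_sum (f x - g x)) I) \<and>
      (\<forall>x. norm (g x) \<le> C * \<alpha>) \<and>
      (\<forall>i\<in>I. \<forall>x. x \<notin> E i \<longrightarrow> b i x = 0) \<and>
      (\<forall>i\<in>I. integrable (flow_measure m) (b i) \<and>
         (LINT x|flow_measure m. norm (b i x)) \<le> 2 * C * \<alpha> * measure (flow_measure m) (E i) \<and>
         (LINT x:E i|flow_measure m. b i x) = 0) \<and>
      (\<Sum>\<^sub>\<infinity>i\<in>I. emeasure (flow_measure m) (E i))
        \<le> ennreal ((LINT x|flow_measure m. norm (f x)) / \<alpha>)"
proof -
  interpret T: infinite_rooted_tree adj \<gamma>
    using tree ray by unfold_locales
  let ?M = "flow_measure m"
  define N where "N = (LINT x|?M. norm (f x))"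
  have m_pos: "0 < m x" and m_sum: "(m has_sum m x) (sons adj \<gamma> x)" for x
    using flow by (auto simp: is_flow_def)
  then have m0: "0 \<le> m x" for x by (simp add: less_imp_le)
  have C_ge: "2 * c \<le> C" "\<beta> - 1 \<le> C" "3 \<le> C" using C by auto
  interpret calderon_zygmund T.parent m c "\<lambda>x. norm (f x)" \<alpha> \<beta> C N
  proof
    show "i = j" if "(T.parent ^^ i) x = (T.parent ^^ j) x" for i j x
      using arg_cong[OF that, of T.lev] by (simp add: T.level_funpow_parent)
    show "\<exists>i j. (T.parent ^^ i) x = (T.parent ^^ j) y" for x y
      by (rule T.common_ancestor)
    show "(m has_sum m x) {y. T.parent y = x}" for x
      using m_sum by (simp add: T.sons_eq)
    show "1 < c" using c by (simp add: flow_constant_def)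
    show "m (T.parent y) \<le> c * m y" for y
      using c by (simp add: flow_constant_def T.sons_eq)
    show "(\<Sum>x\<in>A. norm (f x) * m x) \<le> N" if "finite A" for A
      unfolding N_def using m0 that f by (rule sum_norm_le_flow_integral)
  qed (use m_pos alpha beta C_ge in auto)
  have adm: "admissible adj \<gamma> \<beta> E" if "adm E" for E
  proof -
    have trap: "trapezoid adj \<gamma> a b x = trap a b x" for a b x
      by (auto simp: T.trapezoid_eq gens_def gen_def)
    have "2 \<le> real b / real a \<and> real b / real a \<le> \<beta>"
      if "1 \<le> a" "2 * a \<le> b" "real b \<le> \<beta> * real a" for a b :: nat
      using that by (simp add: le_divide_eq divide_le_eq)
    with that show ?thesis unfolding adm_def admissible_def trap by metis
  qed
  obtain P where P: "disjoint P"
    and bad: "\<And>E. E \<in> P \<Longrightarrow> adm E" "\<And>E. E \<in> P \<Longrightarrow> \<alpha> * mass E < int_F E"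
      "\<And>E. E \<in> P \<Longrightarrow> int_F E \<le> C * \<alpha> * mass E"
    and good: "\<And>x. x \<notin> \<Union>P \<Longrightarrow> norm (f x) \<le> \<alpha>"
    using cz_UNIV unfolding cz_def cz_family_def by auto
  have fin: "finite E" and ne: "E \<noteq> {}" if "E \<in> P" for E
    using adm_finite bad(1,2)[OF that] by auto
  \<comment> \<open>The selected sets are finite subsets of a countable vertex set, so natural
    numbers suffice to index them.\<close>
  have "countable {E :: 'v set. finite E \<and> E \<subseteq> UNIV}"
    by (intro countable_Collect_finite_subset countable_vertices)
  then have cP: "countable P" by (rule countable_subset[rotated]) (use fin in auto)
  define I where "I = to_nat_on P ` P"
  define E where "E = from_nat_into P"
  have EP: "E i \<in> P" if "i \<in> I" for i using that cP by (auto simp: I_def E_def)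
  have bij: "bij_betw E I P"
    unfolding I_def E_def using cP
    by (intro bij_betwI[where g = "to_nat_on P"]) auto
  have disj: "disjoint_family_on E I"
    unfolding disjoint_family_on_def
  proof (intro ballI impI)
    fix i j assume ij: "i \<in> I" "j \<in> I" "i \<noteq> j"
    then have "E i \<noteq> E j" using bij by (auto simp: bij_betw_def inj_on_def)
    with P EP[OF ij(1)] EP[OF ij(2)] show "E i \<inter> E j = {}" by (intro disjointD)
  qed
  define avg where "avg E = (\<Sum>x\<in>E. m x *\<^sub>R f x) /\<^sub>R mass E" for E
  define b where "b i = (\<lambda>x. if x \<in> E i then f x - avg (E i) else 0)" for i
  \<comment> \<open>By disjointness the sum has at most one term at each point: \<open>g\<close> is
    the mean on each \<open>E j\<close> and equals \<open>f\<close> elsewhere.\<close>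
  define g where "g x = f x - (\<Sum>i | i \<in> I \<and> x \<in> E i. b i x)" for x
  have est: "norm (avg (E i)) \<le> C * \<alpha>" "integrable ?M (b i)"
      "(LINT x|?M. norm (b i x)) \<le> 2 * (C * \<alpha>) * measure ?M (E i)"
      "(LINT x:E i|?M. b i x) = 0" if "i \<in> I" for i
    unfolding b_def avg_def using m_pos EP[OF that] fin ne bad(3)
    by (intro bad_part_estimates; blast)+
  have unique: "{i. i \<in> I \<and> x \<in> E i} = {j}" if "j \<in> I" "x \<in> E j" for x j
    using disj that by (auto simp: disjoint_family_on_def)
  have cover: "x \<notin> \<Union>P" if "\<And>i. i \<in> I \<Longrightarrow> x \<notin> E i" for x
    using bij that by (auto simp: bij_betw_def)
  have at_most_one: "finite {i. i \<in> I \<and> x \<in> E i}" for x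
  proof (cases "\<exists>j\<in>I. x \<in> E j")
    case True
    then obtain j where "j \<in> I" "x \<in> E j" by blast
    from unique[OF this] show ?thesis by simp
  next
    case False
    then have "{i. i \<in> I \<and> x \<in> E i} = {}" by blast
    then show ?thesis by (simp only: finite.emptyI)
  qed
  have "((\<lambda>i. b i x) has_sum (f x - g x)) I" for x
    by (rule has_sum_finite_neutralI[OF at_most_one[of x]]) (auto simp: b_def g_def)
  moreover have "norm (g x) \<le> C * \<alpha>" for x
  proof (cases "\<exists>j\<in>I. x \<in> E j")
    case True
    then obtain j where j: "j \<in> I" "x \<in> E j" by blast
    then have "g x = avg (E j)" unfolding g_def unique[OF j] by (simp add: b_def)
    with est(1) j show ?thesis by simp
  next
    case False
    then have "{i. i \<in> I \<and> x \<in> E i} = {}" by blast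
    then have "g x = f x" by (simp only: g_def sum.empty diff_zero)
    moreover have "norm (f x) \<le> \<alpha>" using False by (intro good cover) auto
    moreover have "\<alpha> \<le> C * \<alpha>" using C_ge alpha by simp
    ultimately show ?thesis by simp
  qed
  moreover have "(\<Sum>\<^sub>\<infinity>i\<in>I. emeasure ?M (E i)) \<le> ennreal (N / \<alpha>)"
  proof (rule infsum_le_finite_sums)
    show "(\<lambda>i. emeasure ?M (E i)) summable_on I" by (rule nonneg_summable_on_complete) simp
    fix J assume J: "finite J" "J \<subseteq> I"
    have finE: "finite (E i)" if "i \<in> J" for i using that J EP fin by blast
    have "(\<Sum>i\<in>J. emeasure ?M (E i)) = (\<Sum>i\<in>J. ennreal (mass (E i)))"
      using m0 finE by (intro sum.cong) (auto simp: emeasure_flow_measure)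
    also have "\<dots> = ennreal (\<Sum>i\<in>J. mass (E i))" by (intro sum_ennreal sum_nonneg m0)
    also have "\<dots> \<le> ennreal (N / \<alpha>)"
    proof (rule ennreal_leI)
      \<comment> \<open>Each bad set contributes more than \<open>\<alpha>\<close> times its mass to
        the integral of \<open>norm (f x)\<close>, and by disjointness these contributions add up to
        at most \<open>N\<close>.\<close>
      have "\<alpha> * (\<Sum>i\<in>J. mass (E i)) \<le> (\<Sum>i\<in>J. int_F (E i))"
        unfolding sum_distrib_left[of \<alpha> "\<lambda>i. mass (E i)"]
        using J by (intro sum_mono less_imp_le bad(2) EP) auto
      also have "\<dots> = int_F (\<Union>i\<in>J. E i)"
        using J finE disjoint_family_on_mono[OF J(2) disj]
        by (intro sum.UNION_disjoint_family[symmetric]) auto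
      also have "\<dots> \<le> N" using J finE by (intro F_le) auto
      finally show "(\<Sum>i\<in>J. mass (E i)) \<le> N / \<alpha>" using alpha by (simp add: le_divide_eq mult.commute)
    qed
    finally show "(\<Sum>i\<in>J. emeasure ?M (E i)) \<le> ennreal (N / \<alpha>)" .
  qed
  moreover have "\<forall>i\<in>I. \<forall>x. x \<notin> E i \<longrightarrow> b i x = 0" by (simp add: b_def)
  moreover have "\<forall>i\<in>I. admissible adj \<gamma> \<beta> (E i)" using adm bad(1) EP by blast
  moreover have "\<forall>i\<in>I. integrable ?M (b i) \<and>
      (LINT x|?M. norm (b i x)) \<le> 2 * C * \<alpha> * measure ?M (E i) \<and> (LINT x:E i|?M. b i x) = 0"
    using est(2-4) by (simp add: mult.assoc)
  ultimately show ?thesis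
    using disj unfolding N_def by (intro exI[of _ I] exI[of _ E] exI[of _ g] exI[of _ b] conjI) auto
qed

end
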